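(* Let $(S,N,Z)$ be a structured semigroup. Then the set $\mathcal{C}(S)$ of non-empty cosets is a groupoid under the inverse $C\mapsto C^*$ and the product \[B\cdot C=(BC)^<\quad\text{when}\quad\mathsf{s}(B)=\mathsf{r}(C).\]
   Context: A structured semigroup $(S,N,Z)$ consists of a semigroup $S$, a subsemigroup $N$ of $S$ and a subsemigroup $Z$ of $S$ with $Z\subseteq\mathsf{Z}(N)=\{z\in N:\forall n\in N\ (nz=zn)\}$, such that: (i) for all $a,b\in S$, $ab,ba\in Z$ implies $aZb\cup bZa\subseteq Z$; (ii) for all $a,b\in S$ and $n\in N$, if $abn=n=nab$ and $ab,ba\in Z$ then $bna\in N$. For $a,s,b\in S$: $a<_sb$ means $asb=a=bsa$, $as,sa\in N$ and $bs,sb\in Z$; $a<b$ means $a<_sb$ for some $s\in S$. For $A,B\subseteq S$: $AB=\{ab:a\in A,b\in B\}$, $A^<=\{b\in S:\exists a\in A\ (a<b)\}$ and $A^*=\{s\in S:\exists a\in A\,\exists b\in S\ (a<_sb)\}$. A coset is a $C\subseteq S$ with $CC^*C\subseteq C=C^<$, and $\mathcal{C}(S)=\{C\subseteq S:CC^*C\subseteq C=C^<\neq\emptyset\}$. For a coset $C$, $\mathsf{s}(C)=(C^*C)^<$ (which equals $(C^*C)^*$) and $\mathsf{r}(C)=(CC^* )^<$ (which equals $(CC^* )^*$). A groupoid is a (small) category in which every morphism is invertible, regarded as a set of morphisms with a partially defined product and an inverse operation. *)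

theory Defs
  imports Main "HOL-Library.Set_Algebras"
begin

text \<open>
  The semigroup \<open>S\<close> is the universe of a type of class \<^class>\<open>semigroup_mult\<close>.
  \<open>A * B\<close> on sets is the elementwise product of \<^theory>\<open>HOL-Library.Set_Algebras\<close>.
\<close>

definition subsemigroup :: "'a::semigroup_mult set \<Rightarrow> bool" where
  "subsemigroup A \<longleftrightarrow> A * A \<subseteq> A"

definition centre :: "'a::semigroup_mult set \<Rightarrow> 'a set" where
  "centre N = {z \<in> N. \<forall>n\<in>N. n * z = z * n}"

locale structured_semigroup =
  fixes N Z :: "'a::semigroup_mult set"
  assumes subsemigroup_N: "subsemigroup N"
    and subsemigroup_Z: "subsemigroup Z"
    and Z_central: "Z \<subseteq> centre N"
    and Z_invariant:
      "\<And>a b. a * b \<in> Z \<Longrightarrow> b * a \<in> Z \<Longrightarrow> ({a} * Z * {b}) \<union> ({b} * Z * {a}) \<subseteq> Z"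
    and N_invariant:
      "\<And>a b n. n \<in> N \<Longrightarrow> a * b * n = n \<Longrightarrow> n * a * b = n \<Longrightarrow>
         a * b \<in> Z \<Longrightarrow> b * a \<in> Z \<Longrightarrow> b * n * a \<in> N"


text \<open>\<open>dominated_via N Z a s b\<close> is \<open>a <\<^sub>s b\<close>, and \<open>dominated N Z a b\<close> is \<open>a < b\<close>.\<close>

definition dominated_via ::
  "'a::semigroup_mult set \<Rightarrow> 'a set \<Rightarrow> 'a \<Rightarrow> 'a \<Rightarrow> 'a \<Rightarrow> bool" where
  "dominated_via N Z a s b \<longleftrightarrow>
     a * s * b = a \<and> b * s * a = a \<and>
     a * s \<in> N \<and> s * a \<in> N \<and> b * s \<in> Z \<and> s * b \<in> Z"

definition dominated :: "'a::semigroup_mult set \<Rightarrow> 'a set \<Rightarrow> 'a \<Rightarrow> 'a \<Rightarrow> bool" where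
  "dominated N Z a b \<longleftrightarrow> (\<exists>s. dominated_via N Z a s b)"

text \<open>\<open>up_closure N Z A\<close> is \<open>A\<^sup><\<close> (not assumed to contain \<open>A\<close>), and \<open>star N Z A\<close> is \<open>A\<^sup>*\<close>.\<close>

definition up_closure :: "'a::semigroup_mult set \<Rightarrow> 'a set \<Rightarrow> 'a set \<Rightarrow> 'a set" where
  "up_closure N Z A = {b. \<exists>a\<in>A. dominated N Z a b}"

definition star :: "'a::semigroup_mult set \<Rightarrow> 'a set \<Rightarrow> 'a set \<Rightarrow> 'a set" where
  "star N Z A = {s. \<exists>a\<in>A. \<exists>b. dominated_via N Z a s b}"

definition coset :: "'a::semigroup_mult set \<Rightarrow> 'a set \<Rightarrow> 'a set \<Rightarrow> bool" where
  "coset N Z C \<longleftrightarrow> C * star N Z C * C \<subseteq> C \<and> C = up_closure N Z C"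

definition nonempty_cosets :: "'a::semigroup_mult set \<Rightarrow> 'a set \<Rightarrow> 'a set set" where
  "nonempty_cosets N Z = {C. coset N Z C \<and> C \<noteq> {}}"

definition coset_source :: "'a::semigroup_mult set \<Rightarrow> 'a set \<Rightarrow> 'a set \<Rightarrow> 'a set" where
  "coset_source N Z C = up_closure N Z (star N Z C * C)"

definition coset_range :: "'a::semigroup_mult set \<Rightarrow> 'a set \<Rightarrow> 'a set \<Rightarrow> 'a set" where
  "coset_range N Z C = up_closure N Z (C * star N Z C)"

definition coset_product ::
  "'a::semigroup_mult set \<Rightarrow> 'a set \<Rightarrow> 'a set \<Rightarrow> 'a set \<Rightarrow> 'a set option" where
  "coset_product N Z B C =
     (if coset_source N Z B = coset_range N Z C then Some (up_closure N Z (B * C)) else None)"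


text \<open>
  Small categories in the arrows-only formulation (Mac Lane, Categories for the Working
  Mathematician, I.1): \<open>G\<close> is the set of morphisms and \<open>m a b\<close> is the product of \<open>a\<close> and \<open>b\<close>,
  with \<open>None\<close> standing for an undefined product. The equation \<open>assoc\<close> is between partial
  terms: one side is defined iff the other is.
\<close>

definition identity_arrow :: "'m set \<Rightarrow> ('m \<Rightarrow> 'm \<Rightarrow> 'm option) \<Rightarrow> 'm \<Rightarrow> bool" where
  "identity_arrow G m e \<longleftrightarrow> e \<in> G \<and>
     (\<forall>g\<in>G. m e g \<in> {None, Some g}) \<and> (\<forall>g\<in>G. m g e \<in> {None, Some g})"

locale arrow_category =
  fixes G :: "'m set" and m :: "'m \<Rightarrow> 'm \<Rightarrow> 'm option"
  assumes closed: "\<And>a b c. a \<in> G \<Longrightarrow> b \<in> G \<Longrightarrow> m a b = Some c \<Longrightarrow> c \<in> G"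
    and assoc: "\<And>a b c. a \<in> G \<Longrightarrow> b \<in> G \<Longrightarrow> c \<in> G \<Longrightarrow>
      Option.bind (m a b) (\<lambda>x. m x c) = Option.bind (m b c) (\<lambda>y. m a y)"
    and composable: "\<And>a b c. a \<in> G \<Longrightarrow> b \<in> G \<Longrightarrow> c \<in> G \<Longrightarrow>
      m a b \<noteq> None \<Longrightarrow> m b c \<noteq> None \<Longrightarrow> Option.bind (m a b) (\<lambda>x. m x c) \<noteq> None"
    and left_identity: "\<And>a. a \<in> G \<Longrightarrow> \<exists>e. identity_arrow G m e \<and> m e a \<noteq> None"
    and right_identity: "\<And>a. a \<in> G \<Longrightarrow> \<exists>e. identity_arrow G m e \<and> m a e \<noteq> None"

locale groupoid = arrow_category G m
  for G :: "'m set" and m :: "'m \<Rightarrow> 'm \<Rightarrow> 'm option" +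
  fixes i :: "'m \<Rightarrow> 'm"
  assumes inverse_closed: "\<And>a. a \<in> G \<Longrightarrow> i a \<in> G"
    and left_inverse: "\<And>a. a \<in> G \<Longrightarrow> \<exists>e. identity_arrow G m e \<and> m (i a) a = Some e"
    and right_inverse: "\<And>a. a \<in> G \<Longrightarrow> \<exists>e. identity_arrow G m e \<and> m a (i a) = Some e"

end

theory Submission
  imports Defs
begin

text \<open>
  Read \<open>a <\<^sub>s b\<close> as: \<open>b\<close> is invertible, with inverse \<open>s\<close>, wherever \<open>a\<close> does not vanish. The model
  to keep in mind is a group with \<open>Z = {1}\<close> and \<open>N\<close> a normal submonoid. There \<open>a <\<^sub>s b\<close> says that
  \<open>s = b\<^sup>-\<^sup>1\<close> and \<open>a b\<^sup>-\<^sup>1 \<in> N\<close>, and the non-empty cosets are the cosets, in the usual sense, of the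
  subgroups that contain \<open>N\<close>; such cosets form a groupoid under \<open>g H \<cdot> h K = g h K\<close>, defined
  when \<open>H = h K h\<^sup>-\<^sup>1\<close>.

  Write \<open>A \<odot> B = (A B)\<^sup><\<close>. Since \<open><\<close> is transitive and compatible with products, \<open>\<odot>\<close> is an
  associative operation on the sets with \<open>A = A\<^sup><\<close>. A coset satisfies the regularity law
  \<open>C \<odot> C\<^sup>* \<odot> C = C\<close>, and with \<open>s(C) = C\<^sup>* \<odot> C\<close> and \<open>r(C) = C \<odot> C\<^sup>*\<close> this says that \<open>s(C)\<close> and
  \<open>r(C)\<close> are a right and a left unit for \<open>C\<close>. So the groupoid laws are formal once two facts
  about \<open>*\<close> are known: it is an involution on cosets, and
  \<open>(B \<odot> C)\<^sup>* = C\<^sup>* \<odot> B\<^sup>*\<close> whenever \<open>s(B) = r(C)\<close>. Then for instance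
  \<open>(B \<odot> C) \<odot> (C\<^sup>* \<odot> B\<^sup>*) \<odot> (B \<odot> C) = B \<odot> (B\<^sup>* \<odot> B) \<odot> (B\<^sup>* \<odot> B) \<odot> C = B \<odot> C\<close>,
  so \<open>B \<odot> C\<close> is a coset.

  Both facts need the coset condition \<open>C C\<^sup>* C \<subseteq> C\<close>. If \<open>s \<in> C\<^sup>*\<close> or \<open>s \<in> (B C)\<^sup>*\<close>, the
  available information is that some product such as \<open>b c s\<close> lies in \<open>N\<close>, and this \<open>N\<close>-factor
  has to be absorbed. The key lemma \<open>coset_absorb_right\<close> does so: if \<open>n \<in> N\<close> has an inverse,
  up to \<open>Z\<close>, where \<open>a \<in> C\<close> does not vanish, then \<open>a n \<in> C\<close>. In the model this says that the
  subgroup of which \<open>C\<close> is a left coset contains \<open>N\<close>. The other ingredient for products is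
  \<open>restrict_to_source\<close>: when the source of \<open>B\<close> matches the range of \<open>C\<close>, each \<open>b \<in> B\<close> can be cut
  down to an element of \<open>B\<close> on which a given local unit \<open>c r\<close> of \<open>C\<close> acts trivially.
\<close>

section \<open>Domination and products\<close>

context structured_semigroup
begin

abbreviation via :: "'a \<Rightarrow> 'a \<Rightarrow> 'a \<Rightarrow> bool" ("_ \<lless>[_] _" [51, 0, 51] 50) where
  "a \<lless>[s] b \<equiv> dominated_via N Z a s b"

abbreviation up :: "'a set \<Rightarrow> 'a set" where
  "up A \<equiv> up_closure N Z A"

abbreviation inv_set :: "'a set \<Rightarrow> 'a set" ("_\<^sup>\<star>" [1000] 1000) where
  "A\<^sup>\<star> \<equiv> star N Z A"

abbreviation coset_comp :: "'a set \<Rightarrow> 'a set \<Rightarrow> 'a set" (infixl "\<odot>" 70) where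
  "A \<odot> B \<equiv> up (A * B)"

lemma N_mult: "m \<in> N \<Longrightarrow> n \<in> N \<Longrightarrow> m * n \<in> N"
  using subsemigroup_N unfolding subsemigroup_def by (blast intro: set_times_intro)

lemma Z_subset_N: "z \<in> Z \<Longrightarrow> z \<in> N"
  using Z_central unfolding centre_def by blast

lemma Z_commute: "z \<in> Z \<Longrightarrow> n \<in> N \<Longrightarrow> n * z = z * n"
  using Z_central unfolding centre_def by blast

lemma Z_conjugate:
  assumes "a * b \<in> Z" "b * a \<in> Z" "z \<in> Z"
  shows "a * z * b \<in> Z"
proof -
  have "a * z * b \<in> {a} * Z * {b}"
    using assms(3) by (intro set_times_intro) auto
  then show ?thesis
    using Z_invariant[OF assms(1,2)] by blast
qed

lemma viaI:
  assumes "a * s * b = a" "b * s * a = a" "a * s \<in> N" "s * a \<in> N" "b * s \<in> Z" "s * b \<in> Z"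
  shows "a \<lless>[s] b"
  using assms unfolding dominated_via_def by blast

lemma viaD:
  assumes "a \<lless>[s] b"
  shows "a * s * b = a" "b * s * a = a" "a * s \<in> N" "s * a \<in> N" "b * s \<in> Z" "s * b \<in> Z"
  using assms unfolding dominated_via_def by blast+

text \<open>
  The invariance axiom for \<open>N\<close> only moves those \<open>n\<close> on which \<open>a b\<close> acts trivially. Here \<open>n\<close> may be
  arbitrary, because the factor \<open>a\<close> supplies the trivial action: \<open>a n s = b (s a n) s\<close>, where
  \<open>s b\<close> fixes \<open>s a n\<close>.
\<close>

lemma via_conjugate_N:
  assumes ab: "a \<lless>[s] b" and n: "n \<in> N"
  shows "a * n * s \<in> N" "s * n * a \<in> N"
proof -
  note d = viaD[OF ab]
  have "b * (s * a * n) * s \<in> N"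
  proof (rule N_invariant)
    show "s * a * n \<in> N" using N_mult d n by blast
    show "s * b * (s * a * n) = s * a * n"
      using d(2) by (metis mult.assoc)
    show "s * a * n * s * b = s * a * n"
      using d(1) Z_commute[OF d(6) n] by (metis mult.assoc)
  qed (use d in auto)
  then show "a * n * s \<in> N"
    using d(2) by (metis mult.assoc)
  have "s * (n * (a * s)) * b \<in> N"
  proof (rule N_invariant)
    show "n * (a * s) \<in> N" using N_mult d n by blast
    show "b * s * (n * (a * s)) = n * (a * s)"
      using d(2) Z_commute[OF d(5) n] by (metis mult.assoc)
    show "n * (a * s) * b * s = n * (a * s)"
      using d(1) by (metis mult.assoc)
  qed (use d in auto)
  then show "s * n * a \<in> N"
    using d(1) by (metis mult.assoc)
qed

lemma via_trans:
  assumes ab: "a \<lless>[s] b" and bc: "b \<lless>[t] c"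
  shows "a \<lless>[t] c"
proof (rule viaI)
  note d = viaD[OF ab] and e = viaD[OF bc]
  show "a * t * c = a" using d(1) e(1) by (metis mult.assoc)
  show "c * t * a = a" using d(2) e(2) by (metis mult.assoc)
  have "a * t = (a * s) * (b * t)" using d(1) by (metis mult.assoc)
  then show "a * t \<in> N" using N_mult d e by metis
  have "t * a = (t * b) * (s * a)" using d(2) by (metis mult.assoc)
  then show "t * a \<in> N" using N_mult d e by metis
qed (use viaD[OF bc] in auto)

text \<open>
  The new witness is \<open>t s\<close> because inversion reverses products. The inner factors \<open>c t \<in> N\<close> and
  \<open>s b \<in> Z\<close> commute, which separates \<open>a c t s b d\<close> into \<open>a s b\<close> and \<open>c t d\<close>.
\<close>

lemma via_mult:
  assumes ab: "a \<lless>[s] b" and cd: "c \<lless>[t] d"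
  shows "a * c \<lless>[t * s] b * d"
proof (rule viaI)
  note d = viaD[OF ab] and e = viaD[OF cd]
  have "a * c * (t * s) * (b * d) = a * ((c * t) * (s * b)) * d" by (simp add: mult.assoc)
  also have "\<dots> = (a * s * b) * (c * t * d)"
    using Z_commute[OF d(6) e(3)] by (simp add: mult.assoc)
  finally show "a * c * (t * s) * (b * d) = a * c" using d e by simp
  have "b * d * (t * s) * (a * c) = b * ((d * t) * (s * a)) * c" by (simp add: mult.assoc)
  also have "\<dots> = (b * s * a) * (d * t * c)"
    using Z_commute[OF e(5) d(4)] by (metis mult.assoc)
  finally show "b * d * (t * s) * (a * c) = a * c" using d e by simp
  show "a * c * (t * s) \<in> N"
    using via_conjugate_N(1)[OF ab e(3)] by (simp add: mult.assoc)
  show "t * s * (a * c) \<in> N"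
    using via_conjugate_N(2)[OF cd d(4)] by (simp add: mult.assoc)
  show "b * d * (t * s) \<in> Z"
    using Z_conjugate[OF d(5,6) e(5)] by (simp add: mult.assoc)
  show "t * s * (b * d) \<in> Z"
    using Z_conjugate[OF e(6,5) d(6)] by (simp add: mult.assoc)
qed

text \<open>
  Inverting reverses the roles of \<open>b\<close> and \<open>s\<close>: on the support of \<open>a\<close> they are inverse to each other,
  and \<open>s a s\<close> is \<open>s\<close> cut down to that support.
\<close>

lemma via_swap:
  assumes "a \<lless>[s] b"
  shows "s * a * s \<lless>[b] s"
proof (rule viaI)
  note d = viaD[OF assms]
  show "s * a * s * b * s = s * a * s" using d(1) by (metis mult.assoc)
  show "s * b * (s * a * s) = s * a * s" using d(2) by (metis mult.assoc)
  show "s * a * s * b \<in> N" using d(1,4) by (metis mult.assoc)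
  show "b * (s * a * s) \<in> N" using d(2,3) by (metis mult.assoc)
qed (use viaD[OF assms] in auto)

text \<open>
  This puts the element \<open>s a s\<close> of the preceding lemma into \<open>A\<^sup>*\<close> if \<open>c \<in> A\<close>. Where \<open>c\<close> does not
  vanish, \<open>s\<close> has inverse \<open>b\<close> and \<open>a\<close> has inverse \<open>t\<close>, so \<open>s a s\<close> has inverse \<open>b t b\<close>.
\<close>

lemma via_swap_witness:
  assumes ca: "c \<lless>[t] a" and ab: "a \<lless>[s] b"
  shows "c \<lless>[s * a * s] b * t * b"
proof (rule viaI)
  note d = viaD[OF ab] and e = viaD[OF ca] and g = viaD[OF via_trans[OF ca ab]]
  have "c * (s * a * s) * (b * t * b) = (c * s) * (a * s * b * t) * b"
    by (simp add: mult.assoc)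
  also have "\<dots> = (c * s) * (a * t) * b" by (simp only: d(1))
  also have "\<dots> = (a * t * c) * s * b"
    using Z_commute[OF e(5) g(3)] by (simp add: mult.assoc)
  finally show "c * (s * a * s) * (b * t * b) = c" using e(2) g(1) by simp
  have "b * t * b * (s * a * s) * c = b * t * (b * s * a) * s * c"
    by (simp add: mult.assoc)
  also have "\<dots> = b * ((t * a) * (s * c))" by (simp only: d(2)) (simp add: mult.assoc)
  also have "\<dots> = b * s * (c * t * a)"
    using Z_commute[OF e(6) g(4)] by (simp add: mult.assoc)
  finally show "b * t * b * (s * a * s) * c = c" using e(1) g(2) by simp
  have "c * (s * a * s) = (c * s) * (a * s)" by (simp add: mult.assoc)
  then show "c * (s * a * s) \<in> N" using N_mult d g by metis
  have "s * a * s * c = (s * a) * (s * c)" by (simp add: mult.assoc)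
  then show "s * a * s * c \<in> N" using N_mult d g by metis
  have "b * t * b * (s * a * s) = b * t * (b * s * a) * s" by (simp add: mult.assoc)
  also have "\<dots> = b * (t * a) * s" by (simp only: d(2)) (simp add: mult.assoc)
  finally show "b * t * b * (s * a * s) \<in> Z"
    using Z_conjugate[OF d(5,6) e(6)] by simp
  have "s * a * s * (b * t * b) = s * (a * s * b) * t * b" by (simp add: mult.assoc)
  also have "\<dots> = s * (a * t) * b" by (simp only: d(1)) (simp add: mult.assoc)
  finally show "s * a * s * (b * t * b) \<in> Z"
    using Z_conjugate[OF d(6,5) e(5)] by simp
qed

section \<open>Upward closure and star of arbitrary sets\<close>

lemma upI: "a \<in> A \<Longrightarrow> a \<lless>[s] b \<Longrightarrow> b \<in> up A"
  unfolding up_closure_def dominated_def by blast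

lemma upE:
  assumes "b \<in> up A"
  obtains a s where "a \<in> A" "a \<lless>[s] b"
  using assms unfolding up_closure_def dominated_def by blast

lemma starI: "a \<in> A \<Longrightarrow> a \<lless>[s] b \<Longrightarrow> s \<in> A\<^sup>\<star>"
  unfolding star_def by blast

lemma starE:
  assumes "s \<in> A\<^sup>\<star>"
  obtains a b where "a \<in> A" "a \<lless>[s] b"
  using assms unfolding star_def by blast

lemma up_mono: "A \<subseteq> B \<Longrightarrow> up A \<subseteq> up B"
  unfolding up_closure_def by blast

lemma up_up_subset: "up (up A) \<subseteq> up A"
  by (meson subsetI upE upI via_trans)

lemma up_idem: "A \<subseteq> up A \<Longrightarrow> up (up A) = up A"
  by (simp add: subset_antisym up_mono up_up_subset)

lemma up_mult_subset: "up A * up B \<subseteq> up (A * B)"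
proof
  fix x assume "x \<in> up A * up B"
  then obtain b d where x: "x = b * d" "b \<in> up A" "d \<in> up B"
    by (rule set_times_elim)
  obtain a s where a: "a \<in> A" "a \<lless>[s] b" using x(2) by (rule upE)
  obtain c t where c: "c \<in> B" "c \<lless>[t] d" using x(3) by (rule upE)
  show "x \<in> up (A * B)"
    unfolding x(1) by (rule upI[OF set_times_intro[OF a(1) c(1)] via_mult[OF a(2) c(2)]])
qed

lemma mult_round:
  assumes "A \<subseteq> up A" "B \<subseteq> up B"
  shows "A * B \<subseteq> up (A * B)"
  using set_times_mono2[OF assms] up_mult_subset by (rule order_trans)

lemma up_mult_up:
  assumes "A \<subseteq> up A" "B \<subseteq> up B"
  shows "up (up A * up B) = up (A * B)"
proof
  show "up (up A * up B) \<subseteq> up (A * B)"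
    using up_mono[OF up_mult_subset] up_up_subset by (rule order_trans)
  show "up (A * B) \<subseteq> up (up A * up B)"
    by (rule up_mono[OF set_times_mono2[OF assms]])
qed

lemma coset_comp_closed:
  assumes "A = up A" "B = up B"
  shows "A \<odot> B = up (A \<odot> B)"
  using up_idem[OF mult_round] assms by blast

lemma coset_comp_assoc:
  assumes "A = up A" "B = up B" "C = up C"
  shows "A \<odot> B \<odot> C = A \<odot> (B \<odot> C)"
proof -
  have "A \<odot> B \<odot> C = up (A * B * C)"
    using up_mult_up[of "A * B" C] mult_round assms by (metis order_refl)
  moreover have "A \<odot> (B \<odot> C) = up (A * (B * C))"
    using up_mult_up[of A "B * C"] mult_round assms by (metis order_refl)
  ultimately show ?thesis by (simp add: mult.assoc)
qed

lemma star_up: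
  assumes "A \<subseteq> up A"
  shows "(up A)\<^sup>\<star> = A\<^sup>\<star>"
proof
  show "(up A)\<^sup>\<star> \<subseteq> A\<^sup>\<star>" by (meson starE starI subsetI upE via_trans)
  show "A\<^sup>\<star> \<subseteq> (up A)\<^sup>\<star>" using assms unfolding star_def by blast
qed

text \<open>
  If \<open>c <\<^sub>t a <\<^sub>s b\<close> then \<open>s a s\<close> lies in \<open>A\<^sup>*\<close> and below \<open>s\<close>.
\<close>

lemma star_round:
  assumes "A \<subseteq> up A"
  shows "A\<^sup>\<star> \<subseteq> up (A\<^sup>\<star>)"
proof
  fix s assume "s \<in> A\<^sup>\<star>"
  then obtain a b where a: "a \<in> A" "a \<lless>[s] b" by (rule starE)
  obtain c t where c: "c \<in> A" "c \<lless>[t] a" using a(1) assms upE by blast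
  have "s * a * s \<in> A\<^sup>\<star>" by (rule starI[OF c(1) via_swap_witness[OF c(2) a(2)]])
  then show "s \<in> up (A\<^sup>\<star>)" using via_swap[OF a(2)] by (rule upI)
qed

lemma star_mult_subset: "B\<^sup>\<star> * A\<^sup>\<star> \<subseteq> (A * B)\<^sup>\<star>"
  by (auto elim!: set_times_elim starE intro: starI[OF set_times_intro via_mult])

section \<open>The star operation on cosets\<close>

lemma cosetD:
  assumes "coset N Z C"
  shows "C = up C"
    and "\<And>a s b. a \<in> C \<Longrightarrow> s \<in> C\<^sup>\<star> \<Longrightarrow> b \<in> C \<Longrightarrow> a * s * b \<in> C"
  using assms unfolding coset_def by (blast intro: set_times_intro)+

lemma coset_belowE:
  assumes "coset N Z C" "b \<in> C"
  obtains a s where "a \<in> C" "a \<lless>[s] b"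
  using assms cosetD(1) upE by metis

lemma coset_aboveI:
  assumes "coset N Z C" "a \<in> C" "a \<lless>[s] b"
  shows "b \<in> C"
  using assms cosetD(1) upI by metis

text \<open>
  On the support of \<open>a\<close> the element \<open>m\<close> is an inverse of \<open>n\<close>. The element \<open>n r\<close> belongs to \<open>C\<^sup>*\<close>: it
  is an inverse of \<open>b m\<close> there. So \<open>C\<close> contains \<open>a (n r) b\<close>, and \<open>n\<close> can be moved past the central
  \<open>r b\<close> to give \<open>(a r b) n = a n\<close>.
\<close>

lemma coset_absorb_right:
  assumes C: "coset N Z C" and ab: "a \<in> C" "a \<lless>[r] b"
    and n: "n \<in> N" "n * m \<in> Z" "m * n \<in> Z" "a * (n * m) = a"
  shows "a * n \<in> C"
proof -
  note d = viaD[OF ab(2)]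
  have b: "b \<in> C" using coset_aboveI[OF C ab] .
  \<comment> \<open>Only \<open>n m\<close> is assumed to fix \<open>a\<close>. That \<open>m n\<close> fixes \<open>a\<close> too follows because \<open>n\<close> commutes with
     both, whence \<open>n (m n) = (n m) n = n (n m)\<close>.\<close>
  have "(n * m) * (m * n) = (n * m) * (n * m)"
    using Z_commute[OF n(3,1)] Z_commute[OF n(2) Z_subset_N[OF n(3)]]
      Z_commute[OF n(2,1)] by (metis mult.assoc)
  then have f: "a * (m * n) = a" using n(4) by (metis mult.assoc)
  have "a \<lless>[n * r] b * m"
  proof (rule viaI)
    have "a * (n * r) * (b * m) = a * (n * (r * b)) * m" by (simp add: mult.assoc)
    also have "\<dots> = (a * r * b) * (n * m)"
      using Z_commute[OF d(6) n(1)] by (simp add: mult.assoc)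
    finally show "a * (n * r) * (b * m) = a" using d(1) n(4) by simp
    have "b * m * (n * r) * a = b * ((m * n) * (r * a))" by (simp add: mult.assoc)
    also have "\<dots> = (b * r * a) * (m * n)"
      using Z_commute[OF n(3) d(4)] by (metis mult.assoc)
    finally show "b * m * (n * r) * a = a" using d(2) f by simp
    show "a * (n * r) \<in> N"
      using via_conjugate_N(1)[OF ab(2) n(1)] by (simp add: mult.assoc)
    show "n * r * a \<in> N" using N_mult[OF n(1) d(4)] by (simp add: mult.assoc)
    show "b * m * (n * r) \<in> Z"
      using Z_conjugate[OF d(5,6) n(3)] by (simp add: mult.assoc)
    show "n * r * (b * m) \<in> Z"
      using Z_conjugate[OF n(2,3) d(6)] by (simp add: mult.assoc)
  qed
  then have "a * (n * r) * b \<in> C"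
    using cosetD(2)[OF C] starI ab(1) b by blast
  moreover have "a * (n * r) * b = (a * r * b) * n"
    using Z_commute[OF d(6) n(1)] by (simp add: mult.assoc)
  ultimately show ?thesis using d(1) by simp
qed

text \<open>
  Let \<open>a <\<^sub>s b\<close> with \<open>a \<in> C\<close>. On the support of \<open>a\<close>, \<open>b\<close> is an inverse of \<open>s\<close>, and \<open>s t \<in> N\<close>, so \<open>t\<close>
  should be \<open>b (s t)\<close> there, that is, \<open>b\<close> up to a factor from \<open>N\<close>. Concretely \<open>s t\<close> has the inverse \<open>u b\<close> on the support of \<open>c < a\<close>, so \<open>c (s t) \<in> C\<close> by absorption, and
  \<open>c (s t) <\<^sub>u t\<close>. The two conclusions give \<open>C\<^sup>*\<^sup>* \<subseteq> C\<close> and \<open>C\<^sup>*\<^sup>< \<subseteq> C\<^sup>*\<close>. Neither holds for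
  arbitrary sets with \<open>C = C\<^sup><\<close>.
\<close>

lemma coset_star_upper:
  assumes C: "coset N Z C" and s: "s \<in> C\<^sup>\<star>" "s \<lless>[t] u"
  shows "t \<in> C" "u \<in> C\<^sup>\<star>"
proof -
  obtain a b where a: "a \<in> C" "a \<lless>[s] b" using s(1) by (rule starE)
  obtain c r where c: "c \<in> C" "c \<lless>[r] a" using C a(1) by (rule coset_belowE)
  have cb: "c \<lless>[s] b" using via_trans[OF c(2) a(2)] .
  note d = viaD[OF cb] and e = viaD[OF s(2)]
  have nm: "(s * t) * (u * b) = s * b" using e(1) by (metis mult.assoc)
  have cst: "c * (s * t) \<in> C"
  proof (rule coset_absorb_right[OF C c])
    show "s * t \<in> N" by (rule e(3))
    show "(s * t) * (u * b) \<in> Z" using nm d(6) by simp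
    show "(u * b) * (s * t) \<in> Z"
      using Z_conjugate[OF e(5,6) d(5)] by (simp add: mult.assoc)
    show "c * ((s * t) * (u * b)) = c" using nm d(1) by (simp add: mult.assoc)
  qed
  have below: "c * (s * t) \<lless>[u] t"
  proof (rule viaI)
    show "c * (s * t) * u * t = c * (s * t)" using e(1) by (metis mult.assoc)
    show l: "t * u * (c * (s * t)) = c * (s * t)"
      using Z_commute[OF e(6) d(3)] e(1) by (metis mult.assoc)
    show "c * (s * t) * u \<in> N" using e(1) d(3) by (metis mult.assoc)
    have "u * (c * s) * t \<in> N"
    proof (rule N_invariant)
      show "t * u * (c * s) = c * s"
        using Z_commute[OF e(6) d(3)] e(1) by (metis mult.assoc)
      show "c * s * t * u = c * s" using e(1) by (metis mult.assoc)
    qed (use d e in auto)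
    then show "u * (c * (s * t)) \<in> N" by (simp add: mult.assoc)
  qed (use e in auto)
  show "t \<in> C" using coset_aboveI[OF C cst below] .
  show "u \<in> C\<^sup>\<star>" using starI[OF cst below] .
qed

lemma star_closed:
  assumes "coset N Z C"
  shows "C\<^sup>\<star> = up (C\<^sup>\<star>)"
proof
  show "C\<^sup>\<star> \<subseteq> up (C\<^sup>\<star>)" using star_round cosetD(1)[OF assms] by blast
  show "up (C\<^sup>\<star>) \<subseteq> C\<^sup>\<star>" using coset_star_upper(2)[OF assms] by (meson subsetI upE)
qed

lemma coset_swap_in_star:
  assumes "coset N Z C" "a \<in> C" "a \<lless>[s] b"
  shows "s * a * s \<in> C\<^sup>\<star>"
  using coset_belowE[OF assms(1,2)] via_swap_witness[OF _ assms(3)] starI by metis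

lemma star_star:
  assumes C: "coset N Z C"
  shows "C\<^sup>\<star>\<^sup>\<star> = C"
proof
  show "C\<^sup>\<star>\<^sup>\<star> \<subseteq> C" using coset_star_upper(1)[OF C] by (meson starE subsetI)
  show "C \<subseteq> C\<^sup>\<star>\<^sup>\<star>"
  proof
    fix b assume "b \<in> C"
    with C obtain a s where a: "a \<in> C" "a \<lless>[s] b" by (rule coset_belowE)
    show "b \<in> C\<^sup>\<star>\<^sup>\<star>"
      by (rule starI[OF coset_swap_in_star[OF C a] via_swap[OF a(2)]])
  qed
qed

text \<open>
  For \<open>s, r \<in> C\<^sup>*\<close> and \<open>c \<in> C\<close>, take \<open>a, f, d \<in> C\<close> with \<open>a <\<^sub>s b\<close>, \<open>f <\<^sub>t c\<close> and \<open>d <\<^sub>r e\<close>. Swapping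
  the middle relation gives \<open>t f t <\<^sub>c t\<close> with \<open>t f t \<in> C\<^sup>*\<close>. Multiplying the three relations in
  reverse order makes \<open>s c r\<close> the witness for \<open>d (t f t) a < e t b\<close>, and the smaller side is in
  \<open>C C\<^sup>* C \<subseteq> C\<close>.
\<close>

lemma coset_star:
  assumes C: "coset N Z C"
  shows "coset N Z (C\<^sup>\<star>)"
proof -
  have "s * c * r \<in> C\<^sup>\<star>" if s: "s \<in> C\<^sup>\<star>" and c: "c \<in> C" and r: "r \<in> C\<^sup>\<star>" for s c r
  proof -
    obtain a b where a: "a \<in> C" "a \<lless>[s] b" using s by (rule starE)
    obtain d e where d: "d \<in> C" "d \<lless>[r] e" using r by (rule starE)
    obtain f t where f: "f \<in> C" "f \<lless>[t] c" using C c by (rule coset_belowE)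
    have "d * (t * f * t) * a \<in> C"
      using cosetD(2)[OF C d(1) coset_swap_in_star[OF C f] a(1)] .
    moreover have "d * (t * f * t) * a \<lless>[s * (c * r)] e * t * b"
      by (rule via_mult[OF via_mult[OF d(2) via_swap[OF f(2)]] a(2)])
    ultimately have "s * (c * r) \<in> C\<^sup>\<star>" by (rule starI)
    then show ?thesis by (simp add: mult.assoc)
  qed
  then have "C\<^sup>\<star> * C\<^sup>\<star>\<^sup>\<star> * C\<^sup>\<star> \<subseteq> C\<^sup>\<star>"
    unfolding star_star[OF C] by (auto elim!: set_times_elim)
  then show ?thesis unfolding coset_def using star_closed[OF C] by blast
qed

section \<open>The star of a product\<close>

text \<open>
  The element \<open>z\<close> of the source of \<open>B\<close> dominates some \<open>p q \<in> B\<^sup>* B\<close>. Multiplying \<open>p q\<close>, slightly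
  shrunk, by its inverse \<open>Q P\<close> gives \<open>n = p' q' Q P \<in> N\<close>, which \<open>e\<close> fixes because it fixes \<open>z\<close>. Then
  \<open>a n \<in> B (B\<^sup>* B) (B\<^sup>* B) \<subseteq> B\<close> is the required restriction of \<open>b\<close>, for any \<open>a < b\<close> in \<open>B\<close>.
\<close>

lemma restrict_to_source:
  assumes B: "coset N Z B" and b: "b \<in> B" and z: "z \<in> B\<^sup>\<star> \<odot> B" "z \<in> N"
    and e: "e \<in> Z" "e * z = z"
  obtains a t where "a \<in> B" "a \<lless>[t] b" "a * e = a"
proof -
  obtain x w where x: "x \<in> B\<^sup>\<star> * B" "x \<lless>[w] z" using z(1) by (rule upE)
  obtain p q where pq: "x = p * q" "p \<in> B\<^sup>\<star>" "q \<in> B" using x(1) by (rule set_times_elim)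
  obtain p' P where p': "p' \<in> B\<^sup>\<star>" "p' \<lless>[P] p"
    using coset_star[OF B] pq(2) by (rule coset_belowE)
  obtain q' Q where q': "q' \<in> B" "q' \<lless>[Q] q" using B pq(3) by (rule coset_belowE)
  have xx: "p' * q' \<lless>[Q * P] x" unfolding pq(1) by (rule via_mult[OF p'(2) q'(2)])
  define n where "n = p' * q' * (Q * P)"
  have n: "n \<in> N" unfolding n_def using viaD(3)[OF xx] .
  have "e * x = x" using viaD(2)[OF x(2)] e(2) by (metis mult.assoc)
  then have "e * n = n" unfolding n_def using viaD(2)[OF xx] by (metis mult.assoc)
  then have ne: "n * e = n" using Z_commute[OF e(1) n] by simp
  obtain a t where a: "a \<in> B" "a \<lless>[t] b" using B b by (rule coset_belowE)
  note d = viaD[OF a(2)]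
  have "a * p' * (q' * Q * P) \<in> B"
    using cosetD(2)[OF B] a(1) p'(1) q'(1) starI[OF q'] star_star[OF B] starI[OF p'] by metis
  then have 1: "a * n \<in> B" by (simp add: n_def mult.assoc)
  have 2: "a * n \<lless>[t] b"
  proof (rule viaI)
    show "a * n * t * b = a * n"
      using Z_commute[OF d(6) n] d(1) by (metis mult.assoc)
    show "b * t * (a * n) = a * n" using d(2) by (metis mult.assoc)
    show "a * n * t \<in> N" using via_conjugate_N(1)[OF a(2) n] .
    show "t * (a * n) \<in> N" using N_mult[OF d(4) n] by (simp add: mult.assoc)
  qed (use d in auto)
  have "a * n * e = a * n" using ne by (simp add: mult.assoc)
  then show thesis using that 1 2 by blast
qed

text \<open>
  Given \<open>b c <\<^sub>s d\<close>, the aim is an element of \<open>C\<^sup>* B\<^sup>*\<close> below \<open>s\<close>. If \<open>t\<close> and \<open>r\<close> are inverses of \<open>b\<close> and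
  \<open>c\<close> on smaller supports, then \<open>r t\<close> is one of \<open>b c\<close>, so \<open>s\<close> should agree with \<open>r t (b c s)\<close>
  there. The factor \<open>b c s \<in> N\<close> is absorbed into \<open>B\<^sup>*\<close>, with inverse \<open>d r t\<close>. This absorption
  requires \<open>c r\<close> to act trivially on \<open>b\<close>, and that is where the source of \<open>B\<close> and the range of
  \<open>C\<close> have to be compared.
\<close>

lemma star_mult:
  assumes B: "coset N Z B" and C: "coset N Z C" and CB: "C * C\<^sup>\<star> \<subseteq> B\<^sup>\<star> \<odot> B"
  shows "(B * C)\<^sup>\<star> \<subseteq> C\<^sup>\<star> \<odot> B\<^sup>\<star>"
proof
  fix s assume "s \<in> (B * C)\<^sup>\<star>"
  then obtain x d where x: "x \<in> B * C" "x \<lless>[s] d" by (rule starE)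
  obtain b0 c0 where bc0: "x = b0 * c0" "b0 \<in> B" "c0 \<in> C" using x(1) by (rule set_times_elim)
  obtain c r0 where c: "c \<in> C" "c \<lless>[r0] c0" using C bc0(3) by (rule coset_belowE)
  obtain c' r where c': "c' \<in> C" "c' \<lless>[r] c" using C c(1) by (rule coset_belowE)
  note dc = viaD[OF c'(2)]
  obtain b t0 where b: "b \<in> B" "b \<lless>[t0] b0" "b * (c * r) = b"
  proof (rule restrict_to_source[OF B bc0(2), of "c' * r" "c * r"])
    show "c' * r \<in> B\<^sup>\<star> \<odot> B"
      using CB c'(1) starI[OF c'] by (blast intro: set_times_intro)
    show "c * r * (c' * r) = c' * r" using dc(2) by (metis mult.assoc)
  qed (use dc in auto)
  have "b * c \<lless>[s] d"
    using via_trans[OF via_mult[OF b(2) c(2)]] x(2) bc0(1) by blast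
  note ds = viaD[OF this]
  obtain b' t where b': "b' \<in> B" "b' \<lless>[t] b" using B b(1) by (rule coset_belowE)
  note dt = viaD[OF b'(2)]
  have b'c: "b' * (c * (s * d)) = b' * c" using dt(1) ds(1) by (metis mult.assoc)
  have b'r: "b' * (c * r) = b'" using dt(1) b(3) by (metis mult.assoc)
  have tB: "t * b' * t \<in> B\<^sup>\<star>" using coset_swap_in_star[OF B b'] .
  have "t * b' * t * (b * c * s) \<in> B\<^sup>\<star>"
  proof (rule coset_absorb_right[OF coset_star[OF B] tB via_swap[OF b'(2)]])
    show "b * c * s \<in> N" by (rule ds(3))
    have "b * (c * (s * d) * r) * t \<in> Z"
      by (rule Z_conjugate[OF dt(5,6) Z_conjugate[OF dc(5,6) ds(6)]])
    then show "b * c * s * (d * r * t) \<in> Z" by (simp add: mult.assoc)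
    have "d * (r * (t * b) * c) * s \<in> Z"
      by (rule Z_conjugate[OF ds(5,6) Z_conjugate[OF dc(6,5) dt(6)]])
    then show "d * r * t * (b * c * s) \<in> Z" by (simp add: mult.assoc)
    have "t * b' * t * (b * c * s * (d * r * t)) = t * (b' * t * b) * c * s * d * r * t"
      by (simp add: mult.assoc)
    also have "\<dots> = t * (b' * (c * (s * d))) * r * t" by (simp only: dt(1)) (simp add: mult.assoc)
    also have "\<dots> = t * (b' * (c * r)) * t" by (simp only: b'c) (simp add: mult.assoc)
    finally show "t * b' * t * (b * c * s * (d * r * t)) = t * b' * t" by (simp only: b'r)
  qed
  moreover have "t * b' * t * (b * c * s) = t * b' * c * s" using dt(1) by (metis mult.assoc)
  ultimately have tb: "t * b' * c * s \<in> B\<^sup>\<star>" by simp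
  \<comment> \<open>The element below \<open>s\<close> is \<open>(r c' r) (t b' c s) \<in> C\<^sup>* B\<^sup>*\<close>. It has the form \<open>k s\<close> with \<open>k \<in> N\<close>,
     so \<open>k s <\<^sub>d s\<close> reduces to the fact that \<open>s d\<close> fixes \<open>k\<close>.\<close>
  define k where "k = r * (c' * r * (t * b')) * c"
  have k: "k \<in> N" unfolding k_def
  proof (rule N_invariant)
    show m: "c' * r * (t * b') \<in> N" using N_mult dc dt by blast
    show l: "c * r * (c' * r * (t * b')) = c' * r * (t * b')" using dc(2) by (metis mult.assoc)
    show "c' * r * (t * b') * c * r = c' * r * (t * b')"
      using Z_commute[OF dc(5) m] l by (simp add: mult.assoc)
  qed (use dc in auto)
  have kr: "k * (s * d) = k" unfolding k_def using b'c by (simp add: mult.assoc)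
  have kl: "s * d * k = k" using Z_commute[OF ds(6) k] kr by simp
  have below: "k * s \<lless>[d] s"
  proof (rule viaI)
    show "k * s * d * s = k * s" using kr by (metis mult.assoc)
    show "s * d * (k * s) = k * s" using kl by (metis mult.assoc)
    show "k * s * d \<in> N" using kr k by (simp add: mult.assoc)
    have "d * k * s \<in> N"
      by (rule N_invariant[OF k kl _ ds(6,5)]) (use kr in \<open>simp add: mult.assoc\<close>)
    then show "d * (k * s) \<in> N" by (simp add: mult.assoc)
  qed (use ds in auto)
  have "k * s = (r * c' * r) * (t * b' * c * s)" unfolding k_def by (simp add: mult.assoc)
  then have "k * s \<in> C\<^sup>\<star> * B\<^sup>\<star>"
    using set_times_intro[OF coset_swap_in_star[OF C c'] tb] by simp
  then show "s \<in> C\<^sup>\<star> \<odot> B\<^sup>\<star>" using below by (rule upI)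
qed

section \<open>Composition of cosets\<close>

lemma coset_regular:
  assumes C: "coset N Z C"
  shows "C \<odot> C\<^sup>\<star> \<odot> C = C"
proof -
  have cl: "C = up C" "C\<^sup>\<star> = up (C\<^sup>\<star>)" using cosetD(1) star_closed C by blast+
  have "C \<odot> C\<^sup>\<star> \<odot> C = up (C * C\<^sup>\<star> * C)"
    using up_mult_up[of "C * C\<^sup>\<star>" C] mult_round cl by (metis order_refl)
  also have "\<dots> = C"
  proof
    have "C * C\<^sup>\<star> * C \<subseteq> C" using C unfolding coset_def by blast
    then show "up (C * C\<^sup>\<star> * C) \<subseteq> C" using up_mono cl(1) by blast
    show "C \<subseteq> up (C * C\<^sup>\<star> * C)"
    proof
      fix b assume "b \<in> C"
      with C obtain a s where a: "a \<in> C" "a \<lless>[s] b" by (rule coset_belowE)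
      obtain c t where c: "c \<in> C" "c \<lless>[t] a" using C a(1) by (rule coset_belowE)
      have "c * t * a \<in> C * C\<^sup>\<star> * C" using a c starI[OF c] by (blast intro: set_times_intro)
      then have "c \<in> C * C\<^sup>\<star> * C" using viaD(1)[OF c(2)] by simp
      then show "b \<in> up (C * C\<^sup>\<star> * C)" using via_trans[OF c(2) a(2)] by (rule upI)
    qed
  qed
  finally show ?thesis .
qed

text \<open>
  That \<open>C\<^sup>* = C\<^sup>*\<^sup><\<close> is known only once \<open>C\<close> is a coset, so the criterion uses a closed set \<open>S\<close> around
  \<open>C\<^sup>*\<close> instead. For \<open>C = A \<odot> B\<close> it will be applied with \<open>S = B\<^sup>* \<odot> A\<^sup>*\<close>.
\<close>

lemma cosetI_comp:
  assumes C: "C = up C" and S: "S = up S" "C\<^sup>\<star> \<subseteq> S" and CSC: "C \<odot> S \<odot> C \<subseteq> C"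
  shows "coset N Z C"
proof -
  have "C * C\<^sup>\<star> * C \<subseteq> C * S * C" using S(2) by (simp add: set_times_mono2)
  also have "\<dots> \<subseteq> C \<odot> S * C" using mult_round C S(1) by (simp add: set_times_mono2)
  also have "\<dots> \<subseteq> C \<odot> S \<odot> C"
    using mult_round coset_comp_closed C S(1) by (metis order_refl)
  finally show ?thesis unfolding coset_def using C CSC by blast
qed

lemma up_coset: "coset N Z C \<Longrightarrow> up C = C"
  using cosetD(1) by simp

lemma up_star: "coset N Z C \<Longrightarrow> up (C\<^sup>\<star>) = C\<^sup>\<star>"
  using star_closed by simp

lemma up_comp: "up A = A \<Longrightarrow> up B = B \<Longrightarrow> up (A \<odot> B) = A \<odot> B"
  using coset_comp_closed by simp

lemma coset_regular_left:
  assumes "coset N Z C" "up X = X"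
  shows "C \<odot> (C\<^sup>\<star> \<odot> (C \<odot> X)) = C \<odot> X"
proof -
  have "C \<odot> (C\<^sup>\<star> \<odot> (C \<odot> X)) = C \<odot> C\<^sup>\<star> \<odot> C \<odot> X"
    using assms by (simp add: coset_comp_assoc up_comp up_coset up_star)
  then show ?thesis using coset_regular[OF assms(1)] by simp
qed

lemma coset_regular_right:
  assumes "coset N Z C"
  shows "C \<odot> (C\<^sup>\<star> \<odot> C) = C"
  using coset_regular[OF assms] assms by (simp add: coset_comp_assoc up_comp up_coset up_star)

text \<open>
  Everything here is calculation with the regularity law and the equation \<open>B\<^sup>* \<odot> B = C \<odot> C\<^sup>*\<close>,
  starting from the inclusion \<open>(B C)\<^sup>* \<subseteq> C\<^sup>* \<odot> B\<^sup>*\<close>. The reverse inclusion holds before taking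
  closures, and \<open>(B \<odot> C)\<^sup>*\<close> is closed as soon as \<open>B \<odot> C\<close> is known to be a coset.
\<close>

lemma
  assumes B: "coset N Z B" and C: "coset N Z C"
    and match: "coset_source N Z B = coset_range N Z C"
  shows coset_comp_coset: "coset N Z (B \<odot> C)"
    and coset_comp_star: "(B \<odot> C)\<^sup>\<star> = C\<^sup>\<star> \<odot> B\<^sup>\<star>"
    and coset_comp_source: "coset_source N Z (B \<odot> C) = coset_source N Z C"
    and coset_comp_range: "coset_range N Z (B \<odot> C) = coset_range N Z B"
proof -
  note closed = up_comp up_coset[OF B] up_coset[OF C] up_star[OF B] up_star[OF C]
  note B' = coset_star[OF B] and C' = coset_star[OF C]
  have match': "B\<^sup>\<star> \<odot> B = C \<odot> C\<^sup>\<star>"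
    using match unfolding coset_source_def coset_range_def .
  have exchange: "C \<odot> (C\<^sup>\<star> \<odot> X) = B\<^sup>\<star> \<odot> (B \<odot> X)" if "up X = X" for X
    using arg_cong[OF match', of "\<lambda>Y. Y \<odot> X"] that by (simp add: coset_comp_assoc closed)
  have CC': "C * C\<^sup>\<star> \<subseteq> B\<^sup>\<star> \<odot> B" unfolding match' using mult_round closed by simp
  have star_eq: "(B \<odot> C)\<^sup>\<star> = (B * C)\<^sup>\<star>"
    by (rule star_up[OF mult_round]) (simp_all add: closed)
  have le: "(B \<odot> C)\<^sup>\<star> \<subseteq> C\<^sup>\<star> \<odot> B\<^sup>\<star>"
    unfolding star_eq by (rule star_mult[OF B C CC'])
  show E: "coset N Z (B \<odot> C)"
  proof (rule cosetI_comp[OF _ _ le])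
    show "B \<odot> C \<odot> (C\<^sup>\<star> \<odot> B\<^sup>\<star>) \<odot> (B \<odot> C) \<subseteq> B \<odot> C"
      by (simp add: coset_comp_assoc closed exchange coset_regular_left[OF B])
  qed (simp_all add: closed)
  show star: "(B \<odot> C)\<^sup>\<star> = C\<^sup>\<star> \<odot> B\<^sup>\<star>"
  proof
    show "C\<^sup>\<star> \<odot> B\<^sup>\<star> \<subseteq> (B \<odot> C)\<^sup>\<star>"
      using up_mono[OF star_mult_subset, of C B] up_star[OF E] unfolding star_eq by simp
  qed (rule le)
  have "C\<^sup>\<star> \<odot> B\<^sup>\<star> \<odot> (B \<odot> C) = C\<^sup>\<star> \<odot> (C \<odot> (C\<^sup>\<star> \<odot> C))"
    by (simp add: coset_comp_assoc closed exchange)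
  then show "coset_source N Z (B \<odot> C) = coset_source N Z C"
    unfolding coset_source_def star coset_regular_right[OF C] .
  have "B \<odot> C \<odot> (C\<^sup>\<star> \<odot> B\<^sup>\<star>) = B \<odot> B\<^sup>\<star>"
    by (simp add: coset_comp_assoc closed exchange coset_regular_left[OF B])
  then show "coset_range N Z (B \<odot> C) = coset_range N Z B"
    unfolding coset_range_def star .
qed

lemma coset_source_star: "coset N Z C \<Longrightarrow> coset_source N Z (C\<^sup>\<star>) = coset_range N Z C"
  unfolding coset_source_def coset_range_def by (simp add: star_star)

lemma coset_range_star: "coset N Z C \<Longrightarrow> coset_range N Z (C\<^sup>\<star>) = coset_source N Z C"
  unfolding coset_source_def coset_range_def by (simp add: star_star)

lemma nonempty_cosetsD: "C \<in> nonempty_cosets N Z \<Longrightarrow> coset N Z C"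
  unfolding nonempty_cosets_def by simp

lemma nonempty_star:
  assumes "C \<in> nonempty_cosets N Z"
  shows "C\<^sup>\<star> \<in> nonempty_cosets N Z"
proof -
  obtain b where C: "coset N Z C" and b: "b \<in> C"
    using assms unfolding nonempty_cosets_def by blast
  obtain a s where "a \<in> C" "a \<lless>[s] b" using C b by (rule coset_belowE)
  then have "C\<^sup>\<star> \<noteq> {}" using starI by blast
  then show ?thesis using coset_star[OF C] unfolding nonempty_cosets_def by simp
qed

lemma nonempty_comp:
  assumes "B \<in> nonempty_cosets N Z" "C \<in> nonempty_cosets N Z"
    and match: "coset_source N Z B = coset_range N Z C"
  shows "B \<odot> C \<in> nonempty_cosets N Z"
proof -
  obtain b c where B: "coset N Z B" "b \<in> B" and C: "coset N Z C" "c \<in> C"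
    using assms unfolding nonempty_cosets_def by blast
  have "b * c \<in> B \<odot> C"
    using mult_round cosetD(1)[OF B(1)] cosetD(1)[OF C(1)] set_times_intro[OF B(2) C(2)] by blast
  then show ?thesis
    using coset_comp_coset[OF B(1) C(1) match] unfolding nonempty_cosets_def by blast
qed

section \<open>Units and the groupoid\<close>

text \<open>
  The source of \<open>C\<close> is the composite of the composable pair \<open>C\<^sup>*\<close>, \<open>C\<close>, so it is a coset which is its
  own source and range. Any \<open>D\<close> composable with it on either side therefore has it as
  range or source, and absorbs it by the regularity law.
\<close>

lemma source_identity:
  assumes "C \<in> nonempty_cosets N Z"
  shows "identity_arrow (nonempty_cosets N Z) (coset_product N Z) (coset_source N Z C)"
    and "coset_range N Z (coset_source N Z C) = coset_source N Z C"
proof -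
  let ?e = "coset_source N Z C"
  note C = nonempty_cosetsD[OF assms]
  note match = coset_source_star[OF C]
  have e: "?e = C\<^sup>\<star> \<odot> C" unfolding coset_source_def ..
  have source: "coset_source N Z ?e = ?e"
    using coset_comp_source[OF coset_star[OF C] C match] unfolding e .
  show range: "coset_range N Z ?e = ?e"
    using coset_comp_range[OF coset_star[OF C] C match] coset_range_star[OF C] unfolding e by simp
  have "?e \<in> nonempty_cosets N Z"
    unfolding e by (rule nonempty_comp[OF nonempty_star[OF assms] assms match])
  moreover have "coset_product N Z ?e D \<in> {None, Some D}"
    if "D \<in> nonempty_cosets N Z" for D
    using coset_regular[OF nonempty_cosetsD[OF that]]
    unfolding coset_product_def source by (auto simp: coset_range_def)
  moreover have "coset_product N Z D ?e \<in> {None, Some D}"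
    if "D \<in> nonempty_cosets N Z" for D
    using coset_regular_right[OF nonempty_cosetsD[OF that]]
    unfolding coset_product_def range by (metis coset_source_def insertCI)
  ultimately show "identity_arrow (nonempty_cosets N Z) (coset_product N Z) ?e"
    unfolding identity_arrow_def by blast
qed

end

theorem theorem7p1:
  fixes N Z :: "'a::semigroup_mult set"
  assumes "structured_semigroup N Z"
  shows "groupoid (nonempty_cosets N Z) (coset_product N Z) (star N Z)"
proof -
  interpret structured_semigroup N Z by (rule assms)
  \<comment> \<open>The range of \<open>C\<close> is the source of \<open>C\<^sup>*\<close>.\<close>
  have id_range: "identity_arrow (nonempty_cosets N Z) (coset_product N Z) (coset_range N Z C)"
    "coset_source N Z (coset_range N Z C) = coset_range N Z C"
    if C: "C \<in> nonempty_cosets N Z" for C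
  proof -
    note C' = nonempty_cosetsD[OF C] and S = nonempty_star[OF C]
    show "identity_arrow (nonempty_cosets N Z) (coset_product N Z) (coset_range N Z C)"
      using source_identity(1)[OF S] coset_source_star[OF C'] by simp
    show "coset_source N Z (coset_range N Z C) = coset_range N Z C"
      using coset_comp_source[OF C' coset_star[OF C']] coset_range_star[OF C']
        coset_source_star[OF C'] unfolding coset_range_def by simp
  qed
  show ?thesis
  proof unfold_locales
    fix A B C
    assume A: "A \<in> nonempty_cosets N Z" and B: "B \<in> nonempty_cosets N Z"
    note A' = nonempty_cosetsD[OF A] and B' = nonempty_cosetsD[OF B]
    show "C \<in> nonempty_cosets N Z" if "coset_product N Z A B = Some C"
      using that nonempty_comp[OF A B] unfolding coset_product_def by (auto split: if_splits)
    assume C: "C \<in> nonempty_cosets N Z"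
    note C' = nonempty_cosetsD[OF C]
    note AB = coset_comp_source[OF A' B'] and BC = coset_comp_range[OF B' C']
    show "Option.bind (coset_product N Z A B) (\<lambda>x. coset_product N Z x C) =
        Option.bind (coset_product N Z B C) (coset_product N Z A)"
      using AB BC coset_comp_assoc[OF cosetD(1)[OF A'] cosetD(1)[OF B'] cosetD(1)[OF C']]
      unfolding coset_product_def by simp
    show "Option.bind (coset_product N Z A B) (\<lambda>x. coset_product N Z x C) \<noteq> None"
      if "coset_product N Z A B \<noteq> None" "coset_product N Z B C \<noteq> None"
      using that AB unfolding coset_product_def by (auto split: if_splits)
  next
    fix C assume C: "C \<in> nonempty_cosets N Z"
    note C' = nonempty_cosetsD[OF C]
    show "\<exists>e. identity_arrow (nonempty_cosets N Z) (coset_product N Z) e \<and> coset_product N Z e C \<noteq> None"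
      using id_range[OF C] unfolding coset_product_def by auto
    show "\<exists>e. identity_arrow (nonempty_cosets N Z) (coset_product N Z) e \<and> coset_product N Z C e \<noteq> None"
      using source_identity[OF C] unfolding coset_product_def by auto
    show "star N Z C \<in> nonempty_cosets N Z" by (rule nonempty_star[OF C])
    show "\<exists>e. identity_arrow (nonempty_cosets N Z) (coset_product N Z) e \<and>
        coset_product N Z (star N Z C) C = Some e"
      using source_identity(1)[OF C] coset_source_star[OF C']
      unfolding coset_product_def coset_source_def by auto
    show "\<exists>e. identity_arrow (nonempty_cosets N Z) (coset_product N Z) e \<and>
        coset_product N Z C (star N Z C) = Some e"
      using id_range(1)[OF C] coset_range_star[OF C']
      unfolding coset_product_def coset_range_def by auto
  qed
qed

end
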